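(* Let $U_1>0$ and $0<\varepsilon<\hbar\omega_D$ be real constants with $\varepsilon$ small enough that $U_1\log(\hbar\omega_D/\varepsilon)>1$. Let $\tau_1>0$ be defined by $$1 = U_1 \int_\varepsilon^{\hbar\omega_D} \frac{1}{\xi} \tanh \frac{\xi}{2\tau_1}\, d\xi,$$ and set $$\Delta = \frac{\sqrt{(\hbar\omega_D - \varepsilon e^{1/U_1})(\hbar\omega_D - \varepsilon e^{-1/U_1})}}{\sinh(1/U_1)}.$$ Then there is a unique nonnegative solution $\Delta_1 : [0, \tau_1] \to [0, \infty)$ to the simple gap equation $$1 = U_1 \int_\varepsilon^{\hbar\omega_D} \frac{1}{\sqrt{\xi^2 + \Delta_1(T)^2}} \tanh \frac{\sqrt{\xi^2 + \Delta_1(T)^2}}{2T}\, d\xi, \qquad 0\le T\le \tau_1,$$ such that the solution $\Delta_1$ is continuous and strictly decreasing on the closed interval $[0, \tau_1]$: $$\Delta_1(0) = \Delta > \Delta_1(T_1) > \Delta_1(T_2) > \Delta_1(\tau_1) = 0, \qquad 0 < T_1 < T_2 < \tau_1.$$ Moreover, the solution $\Delta_1$ is of class $C^2$ on the interval $[0, \tau_1)$ and satisfies $$\Delta_1'(0) = \Delta_1''(0) = 0, \qquad \lim_{T\uparrow\tau_1}\Delta_1'(T) = -\infty.$$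
   Context: Here $\hbar\omega_D>0$ is treated as a single positive real constant ($\hbar$ is the reduced Planck constant, $\omega_D$ the Debye frequency). The variable $T\ge 0$ is the absolute temperature. At $T=0$ the factor $\tanh\frac{\sqrt{\xi^2+\Delta_1(T)^2}}{2T}$ is understood as its limit as $T\downarrow 0$, i.e. as $1$. Derivatives at $T=0$ are one-sided. The condition $U_1\log(\hbar\omega_D/\varepsilon)>1$ is equivalent to the existence of $\tau_1>0$ satisfying its defining equation. *)

theory Defs
  imports "HOL-Analysis.Analysis"
begin

(* The value at T = 0 is the limit as T tends to 0 from above, see thermal_factor_tendsto;
   without the case distinction, division by zero would yield tanh 0 = 0 there. *)
definition thermal_factor :: "real \<Rightarrow> real \<Rightarrow> real" where
  "thermal_factor T E = (if T = 0 then 1 else tanh (E / (2 * T)))"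

lemma thermal_factor_tendsto:
  assumes "E > 0"
  shows "((\<lambda>T. thermal_factor T E) \<longlongrightarrow> thermal_factor 0 E) (at_right 0)"
proof -
  have "filterlim (\<lambda>T::real. E / 2 * inverse T) at_top (at_right 0)"
    using assms
    by (intro filterlim_tendsto_pos_mult_at_top[OF tendsto_const]
          filterlim_inverse_at_top_right) auto
  then have "((\<lambda>T. tanh (E / 2 * inverse T)) \<longlongrightarrow> 1) (at_right 0)"
    by (rule filterlim_compose[OF tanh_real_at_top])
  moreover have "eventually (\<lambda>T. tanh (E / 2 * inverse T) = thermal_factor T E) (at_right 0)"
    unfolding eventually_at_right_field
    by (intro exI[of _ 1]) (auto simp: thermal_factor_def field_simps)
  ultimately show ?thesis
    by (simp add: thermal_factor_def tendsto_cong)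
qed

(* W is the cutoff energy (reduced Planck constant times Debye frequency),
   d the value of the gap at temperature T. *)
definition simple_gap_equation :: "real \<Rightarrow> real \<Rightarrow> real \<Rightarrow> real \<Rightarrow> real \<Rightarrow> bool" where
  "simple_gap_equation U \<epsilon> W T d \<longleftrightarrow>
     1 = U * integral {\<epsilon>..W}
       (\<lambda>\<xi>. 1 / sqrt (\<xi>\<^sup>2 + d\<^sup>2) * thermal_factor T (sqrt (\<xi>\<^sup>2 + d\<^sup>2)))"

(* D is a total function, but only its values on [0, tau] are constrained. *)
definition nonneg_gap_solution ::
  "real \<Rightarrow> real \<Rightarrow> real \<Rightarrow> real \<Rightarrow> (real \<Rightarrow> real) \<Rightarrow> bool" where
  "nonneg_gap_solution U \<epsilon> W \<tau> D \<longleftrightarrow>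
     (\<forall>T\<in>{0..\<tau>}. 0 \<le> D T \<and> simple_gap_equation U \<epsilon> W T (D T))"

end

(*
  Put y = Delta^2, E = sqrt (xi^2 + y) and f(u) = tanh (1 / (2 u)) for u > 0, f(u) = 1 for u <= 0.
  Then f is C^2 on the whole line and flat at 0, and the gap equation reads F(T, y) = 1 / U with
  F(T, y) the integral of f(T / E) / E, which makes sense for all real T and all y > -epsilon^2, so
  that T = 0 is an interior point.  Integrals of the form k(T / E) / E^n are closed under both partial
  derivatives.  F is strictly decreasing in y, and in T for T > 0, which gives existence,
  uniqueness, monotonicity and continuity of y(T); the mean value theorem in y gives
  y' = - F_T / F_y, hence y is C^2 up to the critical temperature, where y' is negative.
  Finally Delta = sqrt y, so Delta' = y' / (2 sqrt y) tends to minus infinity as y tends to 0.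
  Working with y rather than Delta matters since the Delta-derivative of F vanishes at Delta = 0.
*)
theory Submission
  imports Defs "HOL-Real_Asymp.Real_Asymp"
begin

section \<open>The thermal factor as a function of \<open>u = T / E\<close>, and its flatness at the
  origin\<close>

definition thermal :: "real \<Rightarrow> real" where
  "thermal u = (if u \<le> 0 then 1 else tanh (1 / (2 * u)))"

definition thermal' :: "real \<Rightarrow> real" where
  "thermal' u = (if u \<le> 0 then 0 else (tanh (1 / (2 * u)) ^ 2 - 1) / (2 * u\<^sup>2))"

definition thermal'' :: "real \<Rightarrow> real" where
  "thermal'' u = (if u \<le> 0 then 0 else
     (1 - tanh (1 / (2 * u)) ^ 2) * (1 / u ^ 3 - tanh (1 / (2 * u)) / (2 * u ^ 4)))"

text \<open>Only the origin is delicate: the left difference quotient is identically 0 because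
  \<open>f\<close> is constant there, and the right one tends to 0 by the last assumption.\<close>

lemma has_real_derivative_zero_extension:
  fixes f g :: "real \<Rightarrow> real"
  assumes "\<And>u. u > 0 \<Longrightarrow> (f has_real_derivative g u) (at u)"
    and "\<And>u. u \<le> 0 \<Longrightarrow> f u = c" "\<And>u. u \<le> 0 \<Longrightarrow> g u = 0"
    and "((\<lambda>u. (f u - c) / u) \<longlongrightarrow> 0) (at_right 0)"
  shows "(f has_real_derivative g u) (at u)"
proof -
  consider "u > 0" | "u < 0" | "u = 0" by linarith
  then show ?thesis
  proof cases
    case 2
    have "eventually (\<lambda>v. v \<in> {..<0}) (nhds u)"
      using 2 by (intro eventually_nhds_in_open) auto
    then have "eventually (\<lambda>v. c = f v) (nhds u)"
      by eventually_elim (simp add: assms(2))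
    then have "(f has_real_derivative 0) (at u)"
      by (subst DERIV_cong_ev[symmetric, OF refl _ refl, of "\<lambda>_. c"]) auto
    then show ?thesis using 2 assms(3) by simp
  next
    case 3
    have "((\<lambda>v. (f v - c) / v) \<longlongrightarrow> 0) (at_left 0)"
      by (rule tendsto_eventually)
        (auto simp: eventually_at_left_field assms(2) intro!: exI[of _ "-1"])
    with assms(4) have "((\<lambda>v. (f v - c) / v) \<longlongrightarrow> 0) (at 0)"
      by (simp add: filterlim_at_split)
    then show ?thesis
      using 3 assms(2)[of 0] assms(3)[of 0] by (simp add: has_field_derivative_iff)
  qed (use assms(1) in auto)
qed

lemma thermal_has_derivative: "(thermal has_real_derivative thermal' u) (at u)"
proof (rule has_real_derivative_zero_extension[where c = 1])
  fix u :: real assume u: "u > 0"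
  have "((\<lambda>u. tanh (1 / (2 * u))) has_real_derivative thermal' u) (at u)"
    using u by (auto intro!: derivative_eq_intros simp: thermal'_def power2_eq_square field_simps)
  moreover have "eventually (\<lambda>v. v \<in> {0<..}) (nhds u)"
    using u by (intro eventually_nhds_in_open) auto
  then have "eventually (\<lambda>v. tanh (1 / (2 * v)) = thermal v) (nhds u)"
    by eventually_elim (simp add: thermal_def)
  ultimately show "(thermal has_real_derivative thermal' u) (at u)"
    by (subst DERIV_cong_ev[symmetric, OF refl _ refl]) auto
next
  \<comment> \<open>As \<open>u\<close> decreases to 0, \<open>1 - tanh (1 / (2 * u))\<close>
    behaves like \<open>2 * exp (- 1 / u)\<close>, which beats every power of \<open>u\<close>. The
    exponential form of \<open>tanh\<close> makes this visible to \<open>real_asymp\<close>.\<close>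
  have "((\<lambda>u::real. (tanh (1 / (2 * u)) - 1) / u) \<longlongrightarrow> 0) (at_right 0)"
    unfolding tanh_real_altdef by real_asymp
  moreover have "eventually (\<lambda>u. (tanh (1 / (2 * u)) - 1) / u = (thermal u - 1) / u) (at_right 0)"
    by (auto simp: eventually_at_right_field thermal_def intro!: exI[of _ 1])
  ultimately show "((\<lambda>u. (thermal u - 1) / u) \<longlongrightarrow> 0) (at_right 0)"
    by (rule Lim_transform_eventually)
qed (auto simp: thermal_def thermal'_def)

lemma thermal'_has_derivative: "(thermal' has_real_derivative thermal'' u) (at u)"
proof (rule has_real_derivative_zero_extension[where c = 0])
  fix u :: real assume u: "u > 0"
  have "((\<lambda>u. (tanh (1 / (2 * u)) ^ 2 - 1) / (2 * u\<^sup>2)) has_real_derivative thermal'' u) (at u)"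
    using u by (auto intro!: derivative_eq_intros simp: thermal''_def)
       (simp add: field_simps eval_nat_numeral)
  moreover have "eventually (\<lambda>v. v \<in> {0<..}) (nhds u)"
    using u by (intro eventually_nhds_in_open) auto
  then have "eventually (\<lambda>v. (tanh (1 / (2 * v)) ^ 2 - 1) / (2 * v\<^sup>2) = thermal' v) (nhds u)"
    by eventually_elim (simp add: thermal'_def)
  ultimately show "(thermal' has_real_derivative thermal'' u) (at u)"
    by (subst DERIV_cong_ev[symmetric, OF refl _ refl]) auto
next
  have "((\<lambda>u::real. (tanh (1 / (2 * u)) ^ 2 - 1) / (2 * u\<^sup>2) / u) \<longlongrightarrow> 0) (at_right 0)"
    unfolding tanh_real_altdef by real_asymp
  moreover have "eventually (\<lambda>u. (tanh (1 / (2 * u)) ^ 2 - 1) / (2 * u\<^sup>2) / u = (thermal' u - 0) / u) (at_right 0)"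
    by (auto simp: eventually_at_right_field thermal'_def intro!: exI[of _ 1])
  ultimately show "((\<lambda>u. (thermal' u - 0) / u) \<longlongrightarrow> 0) (at_right 0)"
    by (rule Lim_transform_eventually)
qed (auto simp: thermal''_def thermal'_def)

text \<open>At 0 the factor \<open>1 - tanh (1 / (2 * u)) ^ 2\<close> is exponentially small and
  absorbs the poles of order 3 and 4.\<close>

lemma continuous_thermal'': "continuous_on UNIV thermal''"
proof -
  have "isCont thermal'' u" for u
  proof -
    consider "u > 0" | "u < 0" | "u = 0" by linarith
    then show ?thesis
    proof cases
      case 1
      have "isCont (\<lambda>u. (1 - tanh (1 / (2 * u)) ^ 2) *
          (1 / u ^ 3 - tanh (1 / (2 * u)) / (2 * u ^ 4))) u"
        using 1 by (intro continuous_intros) auto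
      moreover have "eventually (\<lambda>v. v \<in> {0<..}) (nhds u)"
        using 1 by (intro eventually_nhds_in_open) auto
      then have "eventually (\<lambda>v. (1 - tanh (1 / (2 * v)) ^ 2) *
          (1 / v ^ 3 - tanh (1 / (2 * v)) / (2 * v ^ 4)) = thermal'' v) (nhds u)"
        by eventually_elim (simp add: thermal''_def)
      ultimately show ?thesis
        by (subst isCont_cong[symmetric]) auto
    next
      case 2
      have "eventually (\<lambda>v. v \<in> {..<0}) (nhds u)"
        using 2 by (intro eventually_nhds_in_open) auto
      then have "eventually (\<lambda>v. 0 = thermal'' v) (nhds u)"
        by eventually_elim (simp add: thermal''_def)
      then show ?thesis
        by (subst isCont_cong[symmetric, of "\<lambda>_. 0"]) auto
    next
      case 3
      have "((\<lambda>u::real. (1 - tanh (1 / (2 * u)) ^ 2) *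
          (1 / u ^ 3 - tanh (1 / (2 * u)) / (2 * u ^ 4))) \<longlongrightarrow> 0) (at_right 0)"
        unfolding tanh_real_altdef by real_asymp
      moreover have "eventually (\<lambda>u. (1 - tanh (1 / (2 * u)) ^ 2) *
          (1 / u ^ 3 - tanh (1 / (2 * u)) / (2 * u ^ 4)) = thermal'' u) (at_right 0)"
        by (auto simp: eventually_at_right_field thermal''_def intro!: exI[of _ 1])
      ultimately have "(thermal'' \<longlongrightarrow> 0) (at_right 0)"
        by (rule Lim_transform_eventually)
      moreover have "(thermal'' \<longlongrightarrow> 0) (at_left 0)"
        by (rule tendsto_eventually)
          (auto simp: eventually_at_left_field thermal''_def intro!: exI[of _ "-1"])
      ultimately have "(thermal'' \<longlongrightarrow> 0) (at 0)"
        by (simp add: filterlim_at_split)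
      then show ?thesis using 3 by (simp add: isCont_def thermal''_def)
    qed
  qed
  then show ?thesis by (simp add: continuous_at_imp_continuous_on)
qed

lemma thermal_le_1: "thermal u \<le> 1"
  using tanh_real_lt_1[of "1 / (2 * u)"] by (simp add: thermal_def)

lemma thermal'_neg: "u > 0 \<Longrightarrow> thermal' u < 0"
proof -
  have "tanh x ^ 2 < 1" for x :: real
    using tanh_real_bounds[of x] by (simp add: abs_square_less_1 abs_less_iff)
  then show "u > 0 \<Longrightarrow> thermal' u < 0"
    by (simp add: thermal'_def divide_neg_pos)
qed

text \<open>For \<open>u > 0\<close> and \<open>x = 1 / (2 * u)\<close> this is
  \<open>x / cosh x ^ 2 < tanh x\<close>, that is \<open>x < sinh x * cosh x\<close>. It fixes the
  sign of the \<open>y\<close>-derivative of the gap integral.\<close>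

lemma thermal_add_pos: "thermal u + u * thermal' u > 0"
proof (cases "u > 0")
  case True
  define x where "x = 1 / (2 * u)"
  have x: "x > 0" using True by (simp add: x_def)
  have "sinh 0 - 0 < sinh x - x"
  proof (rule DERIV_pos_imp_increasing_open[OF x])
    show "\<exists>y. ((\<lambda>x. sinh x - x) has_real_derivative y) (at v) \<and> 0 < y" if "0 < v" for v :: real
      using that cosh_real_strict_mono[of 0 v]
      by (intro exI[of _ "cosh v - 1"]) (auto intro!: derivative_eq_intros)
  qed (auto intro!: continuous_intros)
  then have "x < sinh x" by simp
  also have "\<dots> \<le> sinh x * cosh x"
    using x by (intro mult_le_cancel_left1[THEN iffD2]) (auto simp: cosh_real_ge_1)
  finally have "x / cosh x ^ 2 < sinh x * cosh x / cosh x ^ 2"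
    by (intro divide_strict_right_mono) auto
  also have "x / cosh x ^ 2 = x * (1 - tanh x ^ 2)"
  proof -
    have "1 - tanh x ^ 2 = (cosh x ^ 2 - sinh x ^ 2) / cosh x ^ 2"
      by (simp add: tanh_def power_divide diff_divide_distrib)
    then show ?thesis by (simp add: hyperbolic_pythagoras)
  qed
  also have "sinh x * cosh x / cosh x ^ 2 = tanh x"
    by (simp add: tanh_def power2_eq_square)
  finally have "x * (1 - tanh x ^ 2) < tanh x" .
  moreover have "thermal u + u * thermal' u = tanh x - (1 - tanh x ^ 2) / (2 * u)"
    using True by (simp add: thermal_def thermal'_def x_def power2_eq_square field_simps)
  moreover have "(1 - tanh x ^ 2) / (2 * u) = x * (1 - tanh x ^ 2)"
    by (simp add: x_def)
  ultimately show ?thesis by simp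
qed (simp add: thermal_def thermal'_def)

lemma continuous_thermal: "continuous_on UNIV thermal"
  and continuous_thermal': "continuous_on UNIV thermal'"
  using thermal_has_derivative thermal'_has_derivative
  by (auto intro!: continuous_at_imp_continuous_on DERIV_isCont)

text \<open>
  With \<open>E = sqrt (\<xi>\<^sup>2 + y)\<close>, the \<open>y\<close>-derivative of \<open>k (T / E) / E ^ n\<close> is
  \<open>energy_dy n k k' (T / E) / E ^ (n + 2)\<close>, because \<open>dE/dy = 1 / (2 * E)\<close>.
\<close>
definition energy_dy :: "nat \<Rightarrow> (real \<Rightarrow> real) \<Rightarrow> (real \<Rightarrow> real) \<Rightarrow> real \<Rightarrow> real" where
  "energy_dy n k k' u = - (real n * k u + u * k' u) / 2"

text \<open>The kernel of the \<open>y\<close>-derivative of \<open>band_int thermal 1\<close>,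
  where it occurs with exponent 3.\<close>

abbreviation "thermal_dy \<equiv> energy_dy 1 thermal thermal'"

definition thermal_dy' :: "real \<Rightarrow> real" where
  "thermal_dy' u = - (2 * thermal' u + u * thermal'' u) / 2"

lemma thermal_dy_has_derivative: "(thermal_dy has_real_derivative thermal_dy' u) (at u)"
  unfolding energy_dy_def[abs_def] thermal_dy'_def
  by (auto intro!: derivative_eq_intros thermal_has_derivative thermal'_has_derivative)

lemma continuous_thermal_dy: "continuous_on UNIV thermal_dy"
  using thermal_dy_has_derivative by (auto intro!: continuous_at_imp_continuous_on DERIV_isCont)

lemma continuous_thermal_dy': "continuous_on UNIV thermal_dy'"
  unfolding thermal_dy'_def by (intro continuous_intros continuous_thermal' continuous_thermal'') auto

lemma thermal_dy_neg: "thermal_dy u < 0"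
  using thermal_add_pos[of u] by (simp add: energy_dy_def)

section \<open>Integrals over the energy band and their dependence on parameters\<close>

locale energy_band =
  fixes \<epsilon> W :: real
  assumes eps_pos: "0 < \<epsilon>" and eps_less_W: "\<epsilon> < W"
begin

text \<open>\<open>band_int thermal 1\<close> is the \<open>F\<close> of the gap equation; other
  kernels and exponents arise from differentiating it.\<close>

definition band_int :: "(real \<Rightarrow> real) \<Rightarrow> nat \<Rightarrow> real \<Rightarrow> real \<Rightarrow> real" where
  "band_int k n T y = integral {\<epsilon>..W} (\<lambda>\<xi>. k (T / sqrt (\<xi>\<^sup>2 + y)) / sqrt (\<xi>\<^sup>2 + y) ^ n)"

lemma energy_pos: "- \<epsilon>\<^sup>2 < y \<Longrightarrow> \<epsilon> \<le> \<xi> \<Longrightarrow> 0 < \<xi>\<^sup>2 + y"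
  using power_mono[of \<epsilon> \<xi> 2] eps_pos by linarith

text \<open>Letting \<open>T\<close> and \<open>y\<close> both depend on a parameter
  \<open>s\<close> covers the partial functions of \<open>F\<close>, the pair \<open>(T, y)\<close>
  itself and the solution curve at once.\<close>

lemma continuous_on_integrand:
  assumes k: "continuous_on UNIV k" and T: "continuous_on S T" and y: "continuous_on S y"
    and "\<And>s. s \<in> S \<Longrightarrow> - \<epsilon>\<^sup>2 < y s"
  shows "continuous_on (S \<times> {\<epsilon>..W})
    (\<lambda>(s, \<xi>). k (T s / sqrt (\<xi>\<^sup>2 + y s)) / sqrt (\<xi>\<^sup>2 + y s) ^ n)"
proof -
  have *: "0 < (snd x)\<^sup>2 + y (fst x)" if "x \<in> S \<times> {\<epsilon>..W}" for x
    using that assms(4) energy_pos by (cases x) auto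
  have ne: "(snd x)\<^sup>2 + y (fst x) \<noteq> 0" if "x \<in> S \<times> {\<epsilon>..W}" for x
    using *[OF that] by simp
  have Ty: "continuous_on (S \<times> {\<epsilon>..W}) (\<lambda>x. T (fst x))"
     "continuous_on (S \<times> {\<epsilon>..W}) (\<lambda>x. y (fst x))"
    by (auto intro!: continuous_on_compose2[OF T] continuous_on_compose2[OF y] continuous_intros)
  have E: "continuous_on (S \<times> {\<epsilon>..W}) (\<lambda>x. sqrt ((snd x)\<^sup>2 + y (fst x)))"
    by (intro continuous_on_real_sqrt continuous_on_add continuous_on_power continuous_on_snd
        continuous_on_id Ty)
  have "continuous_on (S \<times> {\<epsilon>..W}) (\<lambda>x. k (T (fst x) / sqrt ((snd x)\<^sup>2 + y (fst x))))"
    using ne by (intro continuous_on_compose2[OF k continuous_on_divide[OF Ty(1) E]]) auto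
  with E show ?thesis
    using ne unfolding split_beta by (intro continuous_on_divide continuous_on_power) auto
qed

lemma continuous_on_band_int:
  assumes "continuous_on UNIV k" "continuous_on S T" "continuous_on S y"
    and "\<And>s. s \<in> S \<Longrightarrow> - \<epsilon>\<^sup>2 < y s"
  shows "continuous_on S (\<lambda>s. band_int k n (T s) (y s))"
  using integral_continuous_on_param[where a = \<epsilon> and b = W, of S
    "\<lambda>s \<xi>. k (T s / sqrt (\<xi>\<^sup>2 + y s)) / sqrt (\<xi>\<^sup>2 + y s) ^ n"]
    continuous_on_integrand[OF assms]
  by (simp add: band_int_def[abs_def])

text \<open>Taking the pair \<open>(T, y)\<close> as the parameter gives joint continuity on an open
  set, which is then composed with the two limits.\<close>

lemma tendsto_band_int:
  assumes k: "continuous_on UNIV k" and y0: "- \<epsilon>\<^sup>2 < y0"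
    and T: "(T \<longlongrightarrow> T0) F" and y: "(y \<longlongrightarrow> y0) F"
  shows "((\<lambda>s. band_int k n (T s) (y s)) \<longlongrightarrow> band_int k n T0 y0) F"
proof -
  have "continuous_on (UNIV \<times> {- \<epsilon>\<^sup>2<..}) (\<lambda>p. band_int k n (fst p) (snd p))"
    by (intro continuous_on_band_int[OF k] continuous_intros) auto
  moreover have "open ((UNIV :: real set) \<times> {- \<epsilon>\<^sup>2<..})"
    by (intro open_Times) auto
  ultimately have "isCont (\<lambda>p. band_int k n (fst p) (snd p)) (T0, y0)"
    using y0 by (auto simp: continuous_on_eq_continuous_at)
  from isCont_tendsto_compose[OF this tendsto_Pair[OF T y]] show ?thesis by simp
qed

lemma continuous_on_integrand_at:
  assumes "continuous_on UNIV k" "- \<epsilon>\<^sup>2 < y"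
  shows "continuous_on {\<epsilon>..W} (\<lambda>\<xi>. k (T / sqrt (\<xi>\<^sup>2 + y)) / sqrt (\<xi>\<^sup>2 + y) ^ n)"
proof -
  have "continuous_on ({0::real} \<times> {\<epsilon>..W})
      (\<lambda>(s, \<xi>). k (T / sqrt (\<xi>\<^sup>2 + y)) / sqrt (\<xi>\<^sup>2 + y) ^ n)"
    using assms by (intro continuous_on_integrand continuous_intros)
  from continuous_on_compose2[OF this, of "{\<epsilon>..W}" "\<lambda>\<xi>. (0, \<xi>)"] show ?thesis
    by (simp add: continuous_on_Pair image_subset_iff)
qed

text \<open>The sign is required only at arguments \<open>T / e\<close> with \<open>e > 0\<close>,
  because \<open>thermal'\<close> has a strict sign only for positive arguments.\<close>

lemma band_int_pos:
  assumes "continuous_on UNIV k" "- \<epsilon>\<^sup>2 < y" "\<And>e. e > 0 \<Longrightarrow> 0 < k (T / e)"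
  shows "0 < band_int k n T y"
proof -
  have "integral {\<epsilon>..W} (\<lambda>_. 0) < band_int k n T y"
    unfolding band_int_def using eps_less_W assms(2,3) energy_pos[OF assms(2)]
    by (intro integral_less_real continuous_on_integrand_at assms(1) continuous_intros) auto
  then show ?thesis by simp
qed

lemma band_int_uminus: "band_int (\<lambda>u. - k u) n T y = - band_int k n T y"
  by (simp add: band_int_def)

lemma band_int_neg:
  assumes "continuous_on UNIV k" "- \<epsilon>\<^sup>2 < y" "\<And>e. e > 0 \<Longrightarrow> k (T / e) < 0"
  shows "band_int k n T y < 0"
  using band_int_pos[of "\<lambda>u. - k u" y T n] assms by (simp add: band_int_uminus continuous_on_minus)

text \<open>Differentiation under the integral sign along a curve \<open>(T t, y t)\<close>.
  Freezing one coordinate gives the partial derivatives; the curve \<open>y = gap_sq T\<close> gives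
  the second derivative of the solution.\<close>

lemma band_int_has_derivative:
  assumes k: "\<And>u. (k has_real_derivative k' u) (at u)" and k': "continuous_on UNIV k'"
    and T: "\<And>t. t \<in> S \<Longrightarrow> (T has_real_derivative T' t) (at t within S)"
    and y: "\<And>t. t \<in> S \<Longrightarrow> (y has_real_derivative y' t) (at t within S)"
    and T': "continuous_on S T'" and y': "continuous_on S y'"
    and ygt: "\<And>t. t \<in> S \<Longrightarrow> - \<epsilon>\<^sup>2 < y t"
    and S: "convex S" "t \<in> S"
  shows "((\<lambda>t. band_int k n (T t) (y t)) has_real_derivative
    T' t * band_int k' (Suc n) (T t) (y t) + y' t * band_int (energy_dy n k k') (n + 2) (T t) (y t)) (at t within S)"
proof -
  define i where "i k n t \<xi> = k (T t / sqrt (\<xi>\<^sup>2 + y t)) / sqrt (\<xi>\<^sup>2 + y t) ^ n"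
    for k :: "real \<Rightarrow> real" and n :: nat and t \<xi>
  have kc: "continuous_on UNIV k"
    using k by (auto intro!: continuous_at_imp_continuous_on DERIV_isCont)
  have dyc: "continuous_on UNIV (energy_dy n k k')"
    unfolding energy_dy_def by (intro continuous_intros kc k') auto
  have Tc: "continuous_on S T" and yc: "continuous_on S y"
    using T y by (auto intro!: DERIV_continuous_on)
  have ic: "continuous_on (S \<times> {\<epsilon>..W}) (\<lambda>(t, \<xi>). i k n t \<xi>)" if "continuous_on UNIV k" for k n
    unfolding i_def by (intro continuous_on_integrand that Tc yc ygt)
  have int: "i k n t integrable_on {\<epsilon>..W}" if "continuous_on UNIV k" "t \<in> S" for k n t
    unfolding i_def[abs_def] by (intro integrable_continuous_real continuous_on_integrand_at that ygt)
  have "((\<lambda>t. integral {\<epsilon>..W} (i k n t)) has_real_derivative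
      integral {\<epsilon>..W} (\<lambda>\<xi>. T' t * i k' (Suc n) t \<xi> + y' t * i (energy_dy n k k') (n + 2) t \<xi>))
      (at t within S)"
  proof (rule leibniz_rule_field_derivative[where a = \<epsilon> and b = W, unfolded cbox_interval])
    fix t \<xi> assume t: "t \<in> S" and \<xi>: "\<xi> \<in> {\<epsilon>..W}"
    define E where "E t = sqrt (\<xi>\<^sup>2 + y t)" for t
    have pos: "0 < \<xi>\<^sup>2 + y t" and Et: "E t > 0"
      using energy_pos[OF ygt[OF t]] \<xi> by (auto simp: E_def)
    have dE: "(E has_real_derivative y' t / (2 * E t)) (at t within S)"
      unfolding E_def[abs_def] using pos
      by (auto intro!: derivative_eq_intros y[OF t] simp: field_simps)
    have du: "((\<lambda>t. T t / E t) has_real_derivative (T' t * E t - T t * (y' t / (2 * E t))) / (E t)\<^sup>2)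
        (at t within S)"
      using Et by (auto intro!: derivative_eq_intros T[OF t] dE simp: power2_eq_square)
    have "((\<lambda>t. k (T t / E t) / E t ^ n) has_real_derivative
       (k' (T t / E t) * ((T' t * E t - T t * (y' t / (2 * E t))) / (E t)\<^sup>2) * E t ^ n -
        k (T t / E t) * (real n * E t ^ (n - 1) * (y' t / (2 * E t)))) / (E t ^ n * E t ^ n))
       (at t within S)"
      using Et by (auto intro!: derivative_eq_intros DERIV_chain2[OF k du] dE)
    also have "(k' (T t / E t) * ((T' t * E t - T t * (y' t / (2 * E t))) / (E t)\<^sup>2) * E t ^ n -
        k (T t / E t) * (real n * E t ^ (n - 1) * (y' t / (2 * E t)))) / (E t ^ n * E t ^ n)
        = T' t * (k' (T t / E t) / E t ^ Suc n) + y' t * (energy_dy n k k' (T t / E t) / E t ^ (n + 2))"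
      \<comment> \<open>The case split removes the truncated exponent \<open>n - 1\<close>; for
        \<open>n = 0\<close> its coefficient \<open>real n\<close> vanishes.\<close>
      using Et by (cases n) (simp_all add: energy_dy_def power2_eq_square field_simps)
    finally show "((\<lambda>t. i k n t \<xi>) has_real_derivative
      T' t * i k' (Suc n) t \<xi> + y' t * i (energy_dy n k k') (n + 2) t \<xi>) (at t within S)"
      by (simp add: i_def E_def)
  next
    have "continuous_on (S \<times> {\<epsilon>..W}) (\<lambda>x. T' (fst x))" "continuous_on (S \<times> {\<epsilon>..W}) (\<lambda>x. y' (fst x))"
      by (auto intro!: continuous_on_compose2[OF T'] continuous_on_compose2[OF y'] continuous_intros)
    then show "continuous_on (S \<times> {\<epsilon>..W})
        (\<lambda>(t, \<xi>). T' t * i k' (Suc n) t \<xi> + y' t * i (energy_dy n k k') (n + 2) t \<xi>)"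
      using ic[OF k', of "Suc n"] ic[OF dyc, of "n + 2"]
      unfolding split_beta by (intro continuous_intros)
  qed (use S int[OF kc] in auto)
  moreover have "integral {\<epsilon>..W} (\<lambda>\<xi>. T' t * i k' (Suc n) t \<xi> + y' t * i (energy_dy n k k') (n + 2) t \<xi>)
    = T' t * band_int k' (Suc n) (T t) (y t) + y' t * band_int (energy_dy n k k') (n + 2) (T t) (y t)"
    unfolding band_int_def i_def[symmetric]
    using int[OF k' S(2), of "Suc n"] int[OF dyc S(2), of "n + 2"]
    by (subst Henstock_Kurzweil_Integration.integral_add) (auto intro!: integrable_on_mult_right)
  ultimately show ?thesis
    by (simp add: band_int_def i_def[abs_def])
qed

end

(* Keeps the exponent 1 in band_int k 1 from being rewritten to Suc 0. *)
declare One_nat_def [simp del]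

section \<open>Monotonicity of the gap integral, its value at zero temperature and an upper
  bound\<close>

context energy_band
begin

lemma band_int_thermal_dy_neg: "- \<epsilon>\<^sup>2 < y \<Longrightarrow> band_int thermal_dy n T y < 0"
  by (intro band_int_neg continuous_thermal_dy thermal_dy_neg)

lemma band_int_thermal'_neg: "- \<epsilon>\<^sup>2 < y \<Longrightarrow> 0 < T \<Longrightarrow> band_int thermal' n T y < 0"
  by (intro band_int_neg continuous_thermal' thermal'_neg) auto

lemma band_int_thermal_has_derivative_y:
  assumes "- \<epsilon>\<^sup>2 < y"
  shows "(band_int thermal 1 T has_real_derivative band_int thermal_dy 3 T y) (at y)"
proof -
  have "(band_int thermal 1 T has_real_derivative 0 * band_int thermal' (Suc 1) T y + 1 * band_int thermal_dy (1 + 2) T y)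
      (at y within {- \<epsilon>\<^sup>2<..})"
    using assms by (intro band_int_has_derivative[of _ _ _ "\<lambda>_. T" _ "\<lambda>y. y"] thermal_has_derivative continuous_thermal'
      continuous_intros) auto
  then show ?thesis
    using assms at_within_open[of y "{- \<epsilon>\<^sup>2<..}"] by (simp add: numeral_3_eq_3)
qed

lemma band_int_thermal_has_derivative_T:
  assumes "- \<epsilon>\<^sup>2 < y"
  shows "((\<lambda>T. band_int thermal 1 T y) has_real_derivative band_int thermal' 2 T y) (at T)"
proof -
  have "((\<lambda>T. band_int thermal 1 T y) has_real_derivative 1 * band_int thermal' (Suc 1) T y + 0 * band_int thermal_dy (1 + 2) T y)
      (at T within UNIV)"
    using assms by (intro band_int_has_derivative[of _ _ _ "\<lambda>T. T" _ "\<lambda>_. y"] thermal_has_derivative continuous_thermal'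
      continuous_intros) auto
  then show ?thesis
    by (simp add: numeral_2_eq_2)
qed

lemma eps2_neg: "0 \<le> y \<Longrightarrow> - \<epsilon>\<^sup>2 < y"
  using eps_pos by (smt (verit) zero_less_power2)

lemma band_int_thermal_less_y:
  assumes "- \<epsilon>\<^sup>2 < y1" "y1 < y2"
  shows "band_int thermal 1 T y2 < band_int thermal 1 T y1"
  using assms(2)
proof (rule DERIV_neg_imp_decreasing)
  fix y assume "y1 \<le> y"
  then show "\<exists>z. DERIV (band_int thermal 1 T) y :> z \<and> z < 0"
    using assms(1) by (intro exI[of _ "band_int thermal_dy 3 T y"] conjI band_int_thermal_has_derivative_y band_int_thermal_dy_neg) auto
qed

text \<open>The \<open>T\<close>-derivative vanishes at \<open>T = 0\<close>, so its sign is used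
  only in the open interval, together with continuity at the end points.\<close>

lemma band_int_thermal_less_T:
  assumes "- \<epsilon>\<^sup>2 < y" "0 \<le> T1" "T1 < T2"
  shows "band_int thermal 1 T2 y < band_int thermal 1 T1 y"
  using assms(3)
proof (rule DERIV_neg_imp_decreasing_open)
  fix T assume "T1 < T"
  then show "\<exists>z. DERIV (\<lambda>T. band_int thermal 1 T y) T :> z \<and> z < 0"
    using assms by (intro exI[of _ "band_int thermal' 2 T y"] conjI band_int_thermal_has_derivative_T band_int_thermal'_neg) auto
qed (intro continuous_on_band_int continuous_thermal continuous_intros, use assms in auto)

lemma band_int_thermal_nonpos_T:
  assumes "- \<epsilon>\<^sup>2 < y" "T \<le> 0"
  shows "band_int thermal n T y = band_int thermal n 0 y"
  unfolding band_int_def using assms energy_pos[OF assms(1)]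
  by (intro Henstock_Kurzweil_Integration.integral_cong)
     (auto simp: thermal_def divide_le_0_iff not_le less_imp_le)

text \<open>The integral is constant for \<open>T \<le> 0\<close>, so a nonpositive
  \<open>T1\<close> can be replaced by 0.\<close>

lemma band_int_thermal_strict_below:
  assumes "- \<epsilon>\<^sup>2 < y" "T1 < T2" "0 < T2"
  shows "band_int thermal 1 T2 y < band_int thermal 1 T1 y"
  using band_int_thermal_less_T[OF assms(1), of 0 T2] band_int_thermal_less_T[OF assms(1), of T1 T2]
    band_int_thermal_nonpos_T[OF assms(1), of T1 1] assms(2,3)
  by (cases "T1 \<le> 0") auto

text \<open>At \<open>T = 0\<close> the thermal factor is 1, and
  \<open>1 / sqrt (\<xi>\<^sup>2 + y)\<close> has the antiderivative
  \<open>ln (\<xi> + sqrt (\<xi>\<^sup>2 + y))\<close>.\<close>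

lemma band_int_thermal_zero_temperature:
  assumes "0 \<le> y"
  shows "band_int thermal 1 0 y = ln ((W + sqrt (W\<^sup>2 + y)) / (\<epsilon> + sqrt (\<epsilon>\<^sup>2 + y)))"
proof -
  have "((\<lambda>\<xi>. 1 / sqrt (\<xi>\<^sup>2 + y)) has_integral
      ln (W + sqrt (W\<^sup>2 + y)) - ln (\<epsilon> + sqrt (\<epsilon>\<^sup>2 + y))) {\<epsilon>..W}"
  proof (rule fundamental_theorem_of_calculus)
    fix \<xi> assume "\<xi> \<in> {\<epsilon>..W}"
    then have "0 < \<xi>" and pos: "0 < \<xi>\<^sup>2 + y" using eps_pos assms by (auto simp: add_pos_nonneg)
    then have "0 < \<xi> + sqrt (\<xi>\<^sup>2 + y)" by (intro add_pos_pos) auto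
    then have "((\<lambda>\<xi>. ln (\<xi> + sqrt (\<xi>\<^sup>2 + y))) has_real_derivative 1 / sqrt (\<xi>\<^sup>2 + y)) (at \<xi>)"
      using pos by (auto intro!: derivative_eq_intros simp: divide_simps)
    then show "((\<lambda>\<xi>. ln (\<xi> + sqrt (\<xi>\<^sup>2 + y))) has_vector_derivative 1 / sqrt (\<xi>\<^sup>2 + y))
        (at \<xi> within {\<epsilon>..W})"
      by (metis has_real_derivative_iff_has_vector_derivative has_field_derivative_at_within)
  qed (use eps_less_W in simp)
  moreover have "0 < \<epsilon> + sqrt (\<epsilon>\<^sup>2 + y)" "0 < W + sqrt (W\<^sup>2 + y)"
    using eps_pos eps_less_W assms by (auto intro!: add_pos_nonneg)
  ultimately show ?thesis
    by (simp add: band_int_def thermal_def integral_unique ln_div)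
qed

text \<open>Follows from \<open>thermal \<le> 1\<close> and \<open>E \<ge> sqrt y\<close>; it
  supplies the upper end for the intermediate value theorem.\<close>

lemma band_int_thermal_bound:
  assumes "0 < y"
  shows "band_int thermal 1 T y \<le> (W - \<epsilon>) / sqrt y"
proof -
  have y: "- \<epsilon>\<^sup>2 < y" using assms by (smt (verit) zero_le_power2)
  have "band_int thermal 1 T y \<le> integral {\<epsilon>..W} (\<lambda>_. 1 / sqrt y)"
    unfolding band_int_def
  proof (rule integral_le)
    fix \<xi> assume "\<xi> \<in> {\<epsilon>..W}"
    have "sqrt y \<le> sqrt (\<xi>\<^sup>2 + y)" by simp
    then show "thermal (T / sqrt (\<xi>\<^sup>2 + y)) / sqrt (\<xi>\<^sup>2 + y) ^ 1 \<le> 1 / sqrt y"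
      using assms thermal_le_1 by (intro frac_le) auto
  qed (intro integrable_continuous_real continuous_on_integrand_at continuous_thermal y
      continuous_on_const)+
  then show ?thesis using eps_less_W by simp
qed

end

section \<open>The squared gap: existence, uniqueness, monotonicity and continuity\<close>

text \<open>\<open>critical\<close> is the defining equation of the critical temperature, since
  \<open>E = \<xi>\<close> when \<open>y = 0\<close>.\<close>

locale gap_problem = energy_band +
  fixes U \<tau> :: real
  assumes U_pos: "0 < U" and tau_pos: "0 < \<tau>"
    and critical: "band_int thermal 1 \<tau> 0 = 1 / U"
begin

lemma gap_sq_ex:
  assumes "T \<le> \<tau>"
  shows "\<exists>y\<ge>0. band_int thermal 1 T y = 1 / U"
proof -
  \<comment> \<open>Chosen so that the bound \<open>(W - \<epsilon>) / sqrt Y\<close> equals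
    \<open>1 / U\<close>.\<close>
  define Y where "Y = ((W - \<epsilon>) * U)\<^sup>2"
  have Y: "Y > 0" "sqrt Y = (W - \<epsilon>) * U"
    using eps_less_W U_pos by (auto simp: Y_def)
  have "\<exists>y\<ge>0. y \<le> Y \<and> band_int thermal 1 T y = 1 / U"
  proof (rule IVT2')
    show "band_int thermal 1 T Y \<le> 1 / U"
      using band_int_thermal_bound[OF Y(1), of T] Y eps_less_W by simp
    show "1 / U \<le> band_int thermal 1 T 0"
      using band_int_thermal_strict_below[OF eps2_neg[OF order.refl], of T \<tau>] assms tau_pos critical
      by (cases "T = \<tau>") auto
    show "continuous_on {0..Y} (band_int thermal 1 T)"
      by (intro continuous_on_band_int continuous_thermal continuous_intros eps2_neg) auto
  qed (use Y in auto)
  then show ?thesis by auto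
qed

(* Meaningful only for T <= tau; above the critical temperature no such y exists. *)
definition gap_sq :: "real \<Rightarrow> real" where
  "gap_sq T = (SOME y. 0 \<le> y \<and> band_int thermal 1 T y = 1 / U)"

lemma gap_sq_nonneg: "T \<le> \<tau> \<Longrightarrow> 0 \<le> gap_sq T"
  and gap_sq_eq: "T \<le> \<tau> \<Longrightarrow> band_int thermal 1 T (gap_sq T) = 1 / U"
  unfolding gap_sq_def using someI_ex[OF gap_sq_ex] by auto

lemma gap_sq_unique:
  assumes "T \<le> \<tau>" "0 \<le> y" "band_int thermal 1 T y = 1 / U"
  shows "y = gap_sq T"
  using band_int_thermal_less_y[of y "gap_sq T" T] band_int_thermal_less_y[of "gap_sq T" y T] gap_sq_eq[of T] gap_sq_nonneg[of T]
    assms eps2_neg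
  by (cases y "gap_sq T" rule: linorder_cases) auto

lemma gap_sq_tau: "gap_sq \<tau> = 0"
  using gap_sq_unique[of \<tau> 0] critical by simp

lemma gap_sq_gt: "T \<le> \<tau> \<Longrightarrow> - \<epsilon>\<^sup>2 < gap_sq T"
  by (simp add: gap_sq_nonneg eps2_neg)

text \<open>With \<open>F\<close> decreasing in both variables, \<open>y2 \<ge> y1\<close> would
  give \<open>F(T1, y2) \<le> F(T1, y1) = F(T2, y2) < F(T1, y2)\<close>. For
  \<open>T2 \<le> 0\<close> the solution is constant.\<close>

lemma gap_sq_strict_antimono:
  assumes "T1 < T2" "T2 \<le> \<tau>" "0 < T2"
  shows "gap_sq T2 < gap_sq T1"
proof (rule ccontr)
  assume "\<not> gap_sq T2 < gap_sq T1"
  then have "band_int thermal 1 T1 (gap_sq T2) \<le> band_int thermal 1 T1 (gap_sq T1)"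
    using band_int_thermal_less_y[OF gap_sq_gt, of T1 "gap_sq T2" T1] assms by (cases "gap_sq T1 = gap_sq T2") auto
  also have "\<dots> = band_int thermal 1 T2 (gap_sq T2)"
    using assms by (simp add: gap_sq_eq)
  also have "\<dots> < band_int thermal 1 T1 (gap_sq T2)"
    using assms by (intro band_int_thermal_strict_below gap_sq_gt) auto
  finally show False by simp
qed

lemma gap_sq_pos: "T < \<tau> \<Longrightarrow> 0 < gap_sq T"
  using gap_sq_strict_antimono[of T \<tau>] gap_sq_tau tau_pos by simp

text \<open>Bracketing: the strict inequalities \<open>F(T0, y + d) < 1 / U < F(T0, y - d)\<close>
  persist for \<open>T\<close> near \<open>T0\<close>, and monotonicity in \<open>y\<close> then
  traps \<open>gap_sq T\<close> between \<open>y - d\<close> and \<open>y + d\<close>.\<close>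

lemma gap_sq_tendsto:
  assumes "T0 \<le> \<tau>"
  shows "(gap_sq \<longlongrightarrow> gap_sq T0) (at T0 within {..\<tau>})"
proof (rule tendstoI)
  fix e :: real assume "e > 0"
  \<comment> \<open>The bound by \<open>\<epsilon>\<^sup>2 / 2\<close> keeps \<open>y - d\<close> in
    the domain even when \<open>y = 0\<close>.\<close>
  define d where "d = min e (\<epsilon>\<^sup>2 / 2)"
  have d: "0 < d" "d \<le> e" "d < \<epsilon>\<^sup>2"
    using \<open>e > 0\<close> eps_pos by (auto simp: d_def min_def field_simps)
  let ?y = "gap_sq T0"
  have lo: "- \<epsilon>\<^sup>2 < ?y - d" and hi: "- \<epsilon>\<^sup>2 < ?y + d"
    using d gap_sq_nonneg[OF assms] by auto
  have lim: "((\<lambda>T. band_int thermal 1 T y) \<longlongrightarrow> band_int thermal 1 T0 y) (at T0 within {..\<tau>})" if "- \<epsilon>\<^sup>2 < y" for y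
    using that by (intro tendsto_band_int continuous_thermal tendsto_intros)
  have "1 / U < band_int thermal 1 T0 (?y - d)" "band_int thermal 1 T0 (?y + d) < 1 / U"
    using band_int_thermal_less_y[OF lo, of ?y T0] band_int_thermal_less_y[OF gap_sq_gt[OF assms], of "?y + d" T0]
      gap_sq_eq[OF assms] d by auto
  from order_tendstoD(1)[OF lim[OF lo] this(1)] order_tendstoD(2)[OF lim[OF hi] this(2)]
  have "eventually (\<lambda>T. 1 / U < band_int thermal 1 T (?y - d) \<and> band_int thermal 1 T (?y + d) < 1 / U) (at T0 within {..\<tau>})"
    by (rule eventually_conj)
  moreover have "eventually (\<lambda>T. T \<le> \<tau>) (at T0 within {..\<tau>})"
    by (auto simp: eventually_at_filter)
  ultimately show "eventually (\<lambda>T. dist (gap_sq T) (gap_sq T0) < e) (at T0 within {..\<tau>})"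
  proof eventually_elim
    case (elim T)
    have "?y - d < gap_sq T"
      using band_int_thermal_less_y[OF gap_sq_gt[OF elim(2)], of "?y - d" T] elim gap_sq_eq[OF elim(2)]
      by (cases "gap_sq T" "?y - d" rule: linorder_cases) auto
    moreover have "gap_sq T < ?y + d"
      using band_int_thermal_less_y[OF hi, of "gap_sq T" T] elim gap_sq_eq[OF elim(2)]
      by (cases "gap_sq T" "?y + d" rule: linorder_cases) auto
    ultimately show ?case using d by (auto simp: dist_real_def)
  qed
qed

lemma continuous_on_gap_sq: "continuous_on {..\<tau>} gap_sq"
  using gap_sq_tendsto by (simp add: continuous_on_def)

lemma gap_sq_isCont: "T < \<tau> \<Longrightarrow> (gap_sq \<longlongrightarrow> gap_sq T) (at T)"
  using gap_sq_tendsto[of T] at_within_interior[of T "{..\<tau>}"] by simp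

section \<open>Two derivatives of the squared gap by implicit differentiation\<close>

definition gap_sq' :: "real \<Rightarrow> real" where
  "gap_sq' T = - band_int thermal' 2 T (gap_sq T) / band_int thermal_dy 3 T (gap_sq T)"

text \<open>Both points of the curve give the value \<open>1 / U\<close>, so the increment of
  \<open>F\<close> in \<open>y\<close> at fixed \<open>T\<close> cancels the increment in
  \<open>T\<close> at fixed \<open>y = gap_sq T0\<close>. The mean value theorem turns the former
  into \<open>F_y\<close> at an intermediate point \<open>\<eta> T\<close>, which tends to
  \<open>gap_sq T0\<close>.\<close>

lemma gap_sq_has_derivative:
  assumes "T0 < \<tau>"
  shows "(gap_sq has_real_derivative gap_sq' T0) (at T0)"
proof -
  let ?y = "gap_sq T0"
  have y: "- \<epsilon>\<^sup>2 < ?y" using assms gap_sq_gt by simp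
  have "\<exists>\<eta>. \<bar>\<eta> - ?y\<bar> \<le> \<bar>gap_sq T - ?y\<bar> \<and>
      band_int thermal 1 T (gap_sq T) - band_int thermal 1 T ?y = (gap_sq T - ?y) * band_int thermal_dy 3 T \<eta>" if "T \<le> \<tau>" for T
  proof -
    have *: "\<exists>\<eta>>a. \<eta> < b \<and> band_int thermal 1 T b - band_int thermal 1 T a = (b - a) * band_int thermal_dy 3 T \<eta>"
      if "- \<epsilon>\<^sup>2 < a" "a < b" for a b
      using that by (intro MVT2 band_int_thermal_has_derivative_y) auto
    show ?thesis
    proof (cases "gap_sq T" ?y rule: linorder_cases)
      case less
      from *[OF gap_sq_gt[OF that] less] obtain \<eta> where
        "gap_sq T < \<eta>" "\<eta> < ?y" "band_int thermal 1 T ?y - band_int thermal 1 T (gap_sq T) = (?y - gap_sq T) * band_int thermal_dy 3 T \<eta>"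
        by auto
      then show ?thesis by (intro exI[of _ \<eta>]) (auto simp: algebra_simps)
    next
      case greater
      from *[OF y greater] show ?thesis by force
    qed auto
  qed
  then obtain \<eta> where \<eta>: "\<And>T. T \<le> \<tau> \<Longrightarrow> \<bar>\<eta> T - ?y\<bar> \<le> \<bar>gap_sq T - ?y\<bar>"
    and mvt: "\<And>T. T \<le> \<tau> \<Longrightarrow>
      band_int thermal 1 T (gap_sq T) - band_int thermal 1 T ?y = (gap_sq T - ?y) * band_int thermal_dy 3 T (\<eta> T)"
    by metis
  have near: "eventually (\<lambda>T. T \<in> {..<\<tau>}) (at T0)"
    using assms by (intro eventually_at_in_open') auto
  have "((\<lambda>T. gap_sq T - ?y) \<longlongrightarrow> 0) (at T0)"
    using gap_sq_isCont[OF assms] by (simp add: LIM_zero)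
  then have "((\<lambda>T. \<eta> T - ?y) \<longlongrightarrow> 0) (at T0)"
    by (rule Lim_null_comparison[rotated, OF tendsto_norm_zero])
       (use near in eventually_elim, use \<eta> in auto)
  then have "(\<eta> \<longlongrightarrow> ?y) (at T0)" by (rule LIM_zero_cancel)
  then have lim\<eta>: "((\<lambda>T. band_int thermal_dy 3 T (\<eta> T)) \<longlongrightarrow> band_int thermal_dy 3 T0 ?y) (at T0)"
    by (intro tendsto_band_int continuous_thermal_dy y tendsto_intros)
  have neg: "band_int thermal_dy 3 T0 ?y < 0" by (intro band_int_thermal_dy_neg y)
  have "((\<lambda>T. (band_int thermal 1 T ?y - band_int thermal 1 T0 ?y) / (T - T0)) \<longlongrightarrow> band_int thermal' 2 T0 ?y) (at T0)"
    using band_int_thermal_has_derivative_T[OF y] by (simp add: has_field_derivative_iff)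
  from tendsto_divide[OF tendsto_minus[OF this] lim\<eta>] neg
  have "((\<lambda>T. - ((band_int thermal 1 T ?y - band_int thermal 1 T0 ?y) / (T - T0)) / band_int thermal_dy 3 T (\<eta> T)) \<longlongrightarrow> gap_sq' T0) (at T0)"
    by (simp add: gap_sq'_def)
  moreover have "eventually (\<lambda>T. - ((band_int thermal 1 T ?y - band_int thermal 1 T0 ?y) / (T - T0)) / band_int thermal_dy 3 T (\<eta> T) =
      (gap_sq T - ?y) / (T - T0)) (at T0)"
    \<comment> \<open>Near \<open>T0\<close> the denominator stays negative, so division by it is
      legitimate.\<close>
    using near order_tendstoD(2)[OF lim\<eta> neg]
  proof eventually_elim
    case (elim T)
    have "- (band_int thermal 1 T ?y - band_int thermal 1 T0 ?y) = (gap_sq T - ?y) * band_int thermal_dy 3 T (\<eta> T)"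
      using mvt[of T] elim assms gap_sq_eq[of T] gap_sq_eq[of T0] by simp
    then show ?case
      using elim(2) by (simp only: minus_divide_left) simp
  qed
  ultimately show ?thesis
    unfolding has_field_derivative_iff by (rule Lim_transform_eventually)
qed

lemma continuous_band_int_gap_sq:
  assumes "continuous_on UNIV k"
  shows "continuous_on {..\<tau>} (\<lambda>T. band_int k n T (gap_sq T))"
  using assms by (intro continuous_on_band_int continuous_on_gap_sq continuous_intros gap_sq_gt) auto

lemma band_int_thermal_dy_gap_sq_nonzero: "T \<le> \<tau> \<Longrightarrow> band_int thermal_dy n T (gap_sq T) \<noteq> 0"
  using band_int_thermal_dy_neg[OF gap_sq_gt, of T n T] by force

text \<open>The end point \<tau> is included because the limit of the derivative of the gap there
  needs the value \<open>gap_sq' \<tau>\<close>.\<close>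

lemma continuous_gap_sq': "continuous_on {..\<tau>} gap_sq'"
  unfolding gap_sq'_def
  by (intro continuous_intros continuous_band_int_gap_sq continuous_thermal_dy continuous_thermal')
     (simp add: band_int_thermal_dy_gap_sq_nonzero)

lemma band_int_gap_sq_has_derivative:
  assumes k: "\<And>u. (k has_real_derivative k' u) (at u)" and k': "continuous_on UNIV k'"
    and T: "T < \<tau>"
  shows "((\<lambda>T. band_int k n T (gap_sq T)) has_real_derivative
    band_int k' (Suc n) T (gap_sq T) + gap_sq' T * band_int (energy_dy n k k') (n + 2) T (gap_sq T)) (at T)"
proof -
  have "{..<\<tau>} \<subseteq> {..\<tau>}" by auto
  note gap_sq'_cont = continuous_on_subset[OF continuous_gap_sq' this]
  have "((\<lambda>T. band_int k n T (gap_sq T)) has_real_derivative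
    1 * band_int k' (Suc n) T (gap_sq T) + gap_sq' T * band_int (energy_dy n k k') (n + 2) T (gap_sq T)) (at T within {..<\<tau>})"
    using T gap_sq'_cont
    by (intro band_int_has_derivative k k' gap_sq_gt)
       (auto intro!: continuous_intros has_field_derivative_at_within[OF gap_sq_has_derivative])
  then show ?thesis
    using T at_within_open[of T "{..<\<tau>}"] by simp
qed

text \<open>The quotient rule for \<open>gap_sq'\<close>: the two bracketed sums are the total
  derivatives of \<open>F_T\<close> and \<open>F_y\<close> along the solution curve.\<close>

definition gap_sq'' :: "real \<Rightarrow> real" where
  "gap_sq'' T =
    - ((band_int thermal'' 3 T (gap_sq T) +
        gap_sq' T * band_int (energy_dy 2 thermal' thermal'') 4 T (gap_sq T)) *
         band_int thermal_dy 3 T (gap_sq T) -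
       band_int thermal' 2 T (gap_sq T) *
       (band_int thermal_dy' 4 T (gap_sq T) +
        gap_sq' T * band_int (energy_dy 3 thermal_dy thermal_dy') 5 T (gap_sq T))) /
     (band_int thermal_dy 3 T (gap_sq T))\<^sup>2"

lemma gap_sq'_has_derivative:
  assumes "T < \<tau>"
  shows "(gap_sq' has_real_derivative gap_sq'' T) (at T)"
proof -
  define N N' Q Q' where "N T = band_int thermal' 2 T (gap_sq T)"
    and "N' T = band_int thermal'' 3 T (gap_sq T) + gap_sq' T * band_int (energy_dy 2 thermal' thermal'') 4 T (gap_sq T)"
    and "Q T = band_int thermal_dy 3 T (gap_sq T)"
    and "Q' T = band_int thermal_dy' 4 T (gap_sq T) + gap_sq' T * band_int (energy_dy 3 thermal_dy thermal_dy') 5 T (gap_sq T)" for T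
  have n: "Suc 2 = 3" "2 + 2 = (4 :: nat)" "Suc 3 = 4" "3 + 2 = (5 :: nat)" by simp_all
  have Q: "Q T \<noteq> 0"
    using band_int_thermal_dy_gap_sq_nonzero[of T] assms by (simp add: Q_def)
  have N': "(N has_real_derivative N' T) (at T)"
    using band_int_gap_sq_has_derivative[OF thermal'_has_derivative continuous_thermal'' assms, of 2]
    unfolding n N_def[abs_def] N'_def .
  have Q': "(Q has_real_derivative Q' T) (at T)"
    using band_int_gap_sq_has_derivative[OF thermal_dy_has_derivative continuous_thermal_dy' assms, of 3]
    unfolding n Q_def[abs_def] Q'_def .
  have "((\<lambda>T. - N T / Q T) has_real_derivative - (N' T * Q T - N T * Q' T) / (Q T)\<^sup>2) (at T)"
    by (rule DERIV_cong[OF DERIV_divide[OF DERIV_minus[OF N'] Q' Q]])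
       (intro arg_cong2[where f = "(/)"], auto simp: power2_eq_square)
  then show ?thesis
    unfolding gap_sq'_def[abs_def] gap_sq''_def N_def N'_def Q_def Q'_def .
qed

lemma continuous_gap_sq'': "continuous_on {..\<tau>} gap_sq''"
proof -
  have "continuous_on UNIV (energy_dy 2 thermal' thermal'')" "continuous_on UNIV (energy_dy 3 thermal_dy thermal_dy')"
    unfolding energy_dy_def[of 2] energy_dy_def[of 3]
    by (intro continuous_intros continuous_thermal' continuous_thermal'' continuous_thermal_dy continuous_thermal_dy'; simp)+
  then show ?thesis
    unfolding gap_sq''_def
    by (intro continuous_intros continuous_band_int_gap_sq continuous_gap_sq' continuous_thermal_dy continuous_thermal'
        continuous_thermal_dy' continuous_thermal'') (auto simp: band_int_thermal_dy_gap_sq_nonzero)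
qed

text \<open>Both \<open>thermal'\<close> and \<open>thermal''\<close> vanish at 0, so
  \<open>F_T\<close> vanishes there, and every term of \<open>gap_sq''\<close> contains a vanishing
  factor.\<close>

lemma gap_sq_derivatives_0: "gap_sq' 0 = 0" "gap_sq'' 0 = 0"
proof -
  have "band_int thermal' n 0 y = 0" "band_int thermal'' n 0 y = 0" for n y
    by (simp_all add: band_int_def thermal'_def thermal''_def)
  then show "gap_sq' 0 = 0" "gap_sq'' 0 = 0"
    by (simp_all add: gap_sq'_def gap_sq''_def)
qed

lemma gap_sq'_tau_neg: "gap_sq' \<tau> < 0"
  unfolding gap_sq'_def
  by (intro divide_pos_neg) (simp_all add: band_int_thermal_dy_neg band_int_thermal'_neg gap_sq_gt tau_pos)

section \<open>The explicit gap at zero temperature\<close>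

text \<open>The closed form is substituted into the logarithmic formula for \<open>T = 0\<close>,
  and uniqueness identifies it with \<open>gap_sq 0\<close>. The square roots disappear because
  \<open>W\<^sup>2 + y\<close> and \<open>\<epsilon>\<^sup>2 + y\<close> become perfect squares
  through \<open>h\<^sup>2 = s\<^sup>2 + 1\<close>.\<close>

lemma gap_sq_0:
  assumes "1 < U * ln (W / \<epsilon>)"
  shows "gap_sq 0 = (W - \<epsilon> * exp (1 / U)) * (W - \<epsilon> * exp (- 1 / U)) / (sinh (1 / U))\<^sup>2"
    and "0 \<le> (W - \<epsilon> * exp (1 / U)) * (W - \<epsilon> * exp (- 1 / U))"
proof -
  define c where "c = 1 / U"
  define s where "s = sinh c"
  define h where "h = cosh c"
  have c: "0 < c" using U_pos by (simp add: c_def)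
  have s: "0 < s" using c by (simp add: s_def)
  have hs: "h\<^sup>2 = s\<^sup>2 + 1" by (simp add: h_def s_def cosh_square_eq)
  have e: "exp c = h + s" "exp (- c) = h - s"
    by (simp_all add: h_def s_def cosh_plus_sinh cosh_minus_sinh)
  have "c < ln (W / \<epsilon>)" using assms U_pos by (simp add: c_def field_simps)
  then have "exp c < W / \<epsilon>" using eps_pos eps_less_W by (metis exp_less_mono exp_ln divide_pos_pos less_trans)
  then have We: "\<epsilon> * (h + s) < W" using eps_pos by (simp add: e field_simps)
  have h1: "1 \<le> h" by (simp add: h_def cosh_real_ge_1)
  have We': "\<epsilon> * (h - s) < W" using We eps_pos s by (smt (verit) mult_strict_left_mono)
  define y where "y = (W - \<epsilon> * (h + s)) * (W - \<epsilon> * (h - s)) / s\<^sup>2"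
  have y0: "0 \<le> y" using We We' s by (simp add: y_def)
  have ys: "y * s\<^sup>2 = W\<^sup>2 + \<epsilon>\<^sup>2 * (h\<^sup>2 - s\<^sup>2) - 2 * W * \<epsilon> * h"
  proof -
    have "y * s\<^sup>2 = (W - \<epsilon> * (h + s)) * (W - \<epsilon> * (h - s))"
      using s by (simp add: y_def)
    then show ?thesis by (simp add: power2_eq_square algebra_simps)
  qed
  have "W\<^sup>2 + y = ((W * h - \<epsilon>) / s)\<^sup>2"
  proof -
    have "(W\<^sup>2 + y) * s\<^sup>2 = (W * h - \<epsilon>)\<^sup>2"
      using ys hs by algebra
    then show ?thesis using s by (simp add: power_divide field_simps)
  qed
  moreover have "W * 1 \<le> W * h" using h1 eps_pos eps_less_W by (intro mult_left_mono) auto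
  ultimately have sW: "sqrt (W\<^sup>2 + y) = (W * h - \<epsilon>) / s"
    using s eps_less_W by (intro real_sqrt_unique) auto
  have "\<epsilon>\<^sup>2 + y = ((W - \<epsilon> * h) / s)\<^sup>2"
  proof -
    have "(\<epsilon>\<^sup>2 + y) * s\<^sup>2 = (W - \<epsilon> * h)\<^sup>2"
      using ys hs by algebra
    then show ?thesis using s by (simp add: power_divide field_simps)
  qed
  \<comment> \<open>Selects the nonnegative root of the perfect square.\<close>
  moreover have "\<epsilon> * h \<le> W" using We s eps_pos by (smt (verit) mult_strict_left_mono)
  ultimately have se: "sqrt (\<epsilon>\<^sup>2 + y) = (W - \<epsilon> * h) / s"
    using s by (intro real_sqrt_unique) auto
  have "\<epsilon> + sqrt (\<epsilon>\<^sup>2 + y) > 0" using eps_pos y0 by (simp add: add_pos_nonneg)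
  \<comment> \<open>Both sides equal \<open>(W * exp c - \<epsilon>) / s\<close>, since
    \<open>(h + s) * (h - s) = 1\<close>.\<close>
  moreover have "W + sqrt (W\<^sup>2 + y) = exp c * (\<epsilon> + sqrt (\<epsilon>\<^sup>2 + y))"
    unfolding sW se e using s hs by (simp add: field_simps) algebra
  ultimately have "band_int thermal 1 0 y = c"
    using band_int_thermal_zero_temperature[OF y0] by simp
  then have "y = gap_sq 0"
    using y0 tau_pos by (intro gap_sq_unique) (auto simp: c_def)
  then show "gap_sq 0 = (W - \<epsilon> * exp (1 / U)) * (W - \<epsilon> * exp (- 1 / U)) / (sinh (1 / U))\<^sup>2"
    using e by (simp add: y_def c_def s_def)
  show "0 \<le> (W - \<epsilon> * exp (1 / U)) * (W - \<epsilon> * exp (- 1 / U))"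
    using We We' e by (simp add: c_def)
qed

section \<open>From the squared gap back to the gap\<close>

lemma simple_gap_equation_iff:
  assumes "0 \<le> T"
  shows "simple_gap_equation U \<epsilon> W T d \<longleftrightarrow> band_int thermal 1 T (d\<^sup>2) = 1 / U"
proof -
  have "integral {\<epsilon>..W} (\<lambda>\<xi>. 1 / sqrt (\<xi>\<^sup>2 + d\<^sup>2) * thermal_factor T (sqrt (\<xi>\<^sup>2 + d\<^sup>2))) = band_int thermal 1 T (d\<^sup>2)"
    unfolding band_int_def
  proof (rule Henstock_Kurzweil_Integration.integral_cong)
    fix \<xi> assume "\<xi> \<in> {\<epsilon>..W}"
    then have "0 < sqrt (\<xi>\<^sup>2 + d\<^sup>2)" using energy_pos[of "d\<^sup>2" \<xi>] eps2_neg by simp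
    then show "1 / sqrt (\<xi>\<^sup>2 + d\<^sup>2) * thermal_factor T (sqrt (\<xi>\<^sup>2 + d\<^sup>2)) =
        thermal (T / sqrt (\<xi>\<^sup>2 + d\<^sup>2)) / sqrt (\<xi>\<^sup>2 + d\<^sup>2) ^ 1"
      \<comment> \<open>For \<open>T > 0\<close> the arguments of \<open>tanh\<close> agree, as
        \<open>1 / (2 * (T / E)) = E / (2 * T)\<close>; at \<open>T = 0\<close> both sides take the
        value 1 by definition.\<close>
      using assms by (auto simp: thermal_factor_def thermal_def divide_le_0_iff)
  qed
  then show ?thesis
    using U_pos by (auto simp: simple_gap_equation_def field_simps)
qed

end

theorem proposition2:
  fixes U1 \<epsilon> W \<tau>1 \<Delta> :: real
  assumes "U1 > 0" and "0 < \<epsilon>" and "\<epsilon> < W"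
    and "U1 * ln (W / \<epsilon>) > 1"
    and "\<tau>1 > 0"
    and "1 = U1 * integral {\<epsilon>..W} (\<lambda>\<xi>. 1 / \<xi> * tanh (\<xi> / (2 * \<tau>1)))"
    and "\<Delta> = sqrt ((W - \<epsilon> * exp (1 / U1)) * (W - \<epsilon> * exp (- 1 / U1))) / sinh (1 / U1)"
  shows "\<exists>\<Delta>1 :: real \<Rightarrow> real.
      nonneg_gap_solution U1 \<epsilon> W \<tau>1 \<Delta>1 \<and>
      (\<forall>f. nonneg_gap_solution U1 \<epsilon> W \<tau>1 f \<longrightarrow> (\<forall>T\<in>{0..\<tau>1}. f T = \<Delta>1 T)) \<and>
      continuous_on {0..\<tau>1} \<Delta>1 \<and>
      strict_antimono_on {0..\<tau>1} \<Delta>1 \<and>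
      \<Delta>1 0 = \<Delta> \<and> \<Delta>1 \<tau>1 = 0 \<and>
      (\<exists>\<Delta>1' \<Delta>1'' :: real \<Rightarrow> real.
        (\<forall>T\<in>{0..<\<tau>1}. (\<Delta>1 has_real_derivative \<Delta>1' T) (at T within {0..<\<tau>1})) \<and>
        (\<forall>T\<in>{0..<\<tau>1}. (\<Delta>1' has_real_derivative \<Delta>1'' T) (at T within {0..<\<tau>1})) \<and>
        continuous_on {0..<\<tau>1} \<Delta>1'' \<and>
        \<Delta>1' 0 = 0 \<and> \<Delta>1'' 0 = 0 \<and>
        filterlim \<Delta>1' at_bot (at_left \<tau>1))"
proof -
  have E: "sqrt (\<xi>\<^sup>2 + 0) = \<xi>" if "\<xi> \<in> {\<epsilon>..W}" for \<xi>
    using that assms(2) by simp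
  interpret energy_band \<epsilon> W by standard fact+
  have "integral {\<epsilon>..W} (\<lambda>\<xi>. 1 / \<xi> * tanh (\<xi> / (2 * \<tau>1))) = band_int thermal 1 \<tau>1 0"
    unfolding band_int_def
    by (rule Henstock_Kurzweil_Integration.integral_cong)
      (use E assms(2,5) in \<open>auto simp: thermal_def divide_le_0_iff\<close>)
  with assms(1,6) have "band_int thermal 1 \<tau>1 0 = 1 / U1"
    by (simp add: field_simps)
  then interpret gap_problem \<epsilon> W U1 \<tau>1
    using assms(1,5) by unfold_locales
  define D where "D T = sqrt (gap_sq T)" for T
  define D' where "D' T = gap_sq' T / (2 * D T)" for T
  define D'' where "D'' T = (gap_sq'' T * D T - gap_sq' T * D' T) / (2 * (D T)\<^sup>2)" for T
  have Dpos: "D T > 0" if "T < \<tau>1" for T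
    using gap_sq_pos[OF that] by (simp add: D_def)
  have D2: "(D T)\<^sup>2 = gap_sq T" if "T \<le> \<tau>1" for T
    using gap_sq_nonneg[OF that] by (simp add: D_def)
  have dD: "(D has_real_derivative D' T) (at T)" if "T < \<tau>1" for T
    unfolding D_def[abs_def] D'_def
    using gap_sq_pos[OF that] by (auto intro!: derivative_eq_intros gap_sq_has_derivative[OF that] simp: field_simps)
  have dD': "(D' has_real_derivative D'' T) (at T)" if "T < \<tau>1" for T
    unfolding D'_def[abs_def] D''_def using Dpos[OF that]
    by (auto intro!: derivative_eq_intros gap_sq'_has_derivative[OF that] dD[OF that]
        simp: D'_def field_simps power2_eq_square)
  have contD: "continuous_on {..\<tau>1} D"
    unfolding D_def by (intro continuous_on_real_sqrt continuous_on_gap_sq)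
  have contD'': "continuous_on {0..<\<tau>1} D''"
  proof -
    have "continuous_on {0..<\<tau>1} D" "continuous_on {0..<\<tau>1} gap_sq'" "continuous_on {0..<\<tau>1} gap_sq''"
      using contD continuous_gap_sq' continuous_gap_sq'' by (auto elim!: continuous_on_subset)
    moreover have "\<forall>T\<in>{0..<\<tau>1}. 2 * D T \<noteq> 0" "\<forall>T\<in>{0..<\<tau>1}. 2 * (D T)\<^sup>2 \<noteq> 0"
      using Dpos by (auto simp: less_imp_neq[symmetric])
    ultimately show ?thesis
      unfolding D''_def D'_def
      by (intro continuous_on_divide continuous_on_diff continuous_on_mult continuous_on_power continuous_on_const)
  qed
  have bot: "filterlim D' at_bot (at_left \<tau>1)"
  proof -
    \<comment> \<open>Turns continuity on \<open>{..\<tau>1}\<close> into a limit from the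
      left.\<close>
    have left: "at \<tau>1 within {..\<tau>1} = at_left \<tau>1"
      by (rule at_within_nhd[of _ UNIV]) auto
    have "(gap_sq' \<longlongrightarrow> gap_sq' \<tau>1) (at_left \<tau>1)" "(D \<longlongrightarrow> D \<tau>1) (at_left \<tau>1)"
      using continuous_gap_sq'[unfolded continuous_on_def, rule_format, of \<tau>1]
        contD[unfolded continuous_on_def, rule_format, of \<tau>1] by (simp_all only: left atMost_iff order.refl)
    moreover from this(2) have "((\<lambda>T. 2 * D T) \<longlongrightarrow> 0) (at_left \<tau>1)"
      using tendsto_mult_left[of D "D \<tau>1" "at_left \<tau>1" 2] by (simp add: D_def gap_sq_tau)
    moreover have "eventually (\<lambda>T. 0 < 2 * D T) (at_left \<tau>1)"
      using Dpos by (auto simp: eventually_at_filter)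
    \<comment> \<open>The numerator tends to the negative number \<open>gap_sq' \<tau>1\<close>
      while \<open>2 * D T\<close> tends to 0 through positive values.\<close>
    ultimately have "LIM T at_left \<tau>1. gap_sq' T * inverse (2 * D T) :> at_bot"
      by (intro filterlim_tendsto_neg_mult_at_bot[OF _ gap_sq'_tau_neg] filterlim_inverse_at_top)
    then show ?thesis unfolding D'_def[abs_def] divide_inverse .
  qed
  have "f T = D T" if "nonneg_gap_solution U1 \<epsilon> W \<tau>1 f" "T \<in> {0..\<tau>1}" for f T
  proof -
    have "0 \<le> f T" "simple_gap_equation U1 \<epsilon> W T (f T)"
      using that by (auto simp: nonneg_gap_solution_def)
    then have "(f T)\<^sup>2 = gap_sq T"
      using that by (intro gap_sq_unique) (auto simp: simple_gap_equation_iff)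
    then show ?thesis
      unfolding D_def using \<open>0 \<le> f T\<close> by (intro real_sqrt_unique[symmetric])
  qed
  moreover have "nonneg_gap_solution U1 \<epsilon> W \<tau>1 D"
    using gap_sq_nonneg by (auto simp: nonneg_gap_solution_def simple_gap_equation_iff D2 gap_sq_eq)
      (simp add: D_def)
  moreover have "strict_antimono_on {0..\<tau>1} D"
    using gap_sq_strict_antimono by (auto intro!: monotone_onI simp: D_def)
  moreover have "D 0 = \<Delta>"
    using gap_sq_0[OF assms(4)] assms(1,7) by (simp add: D_def real_sqrt_divide)
  moreover have "D \<tau>1 = 0" by (simp add: D_def gap_sq_tau)
  moreover have "continuous_on {0..\<tau>1} D"
    using contD by (auto elim!: continuous_on_subset)
  moreover have "D' 0 = 0" "D'' 0 = 0"
    by (simp_all add: D'_def D''_def gap_sq_derivatives_0)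
  \<comment> \<open>The two-sided derivatives, available at 0 through the extension to negative
    \<open>T\<close>, restrict to the one-sided ones.\<close>
  moreover have "\<forall>T\<in>{0..<\<tau>1}. (D has_real_derivative D' T) (at T within {0..<\<tau>1})"
    "\<forall>T\<in>{0..<\<tau>1}. (D' has_real_derivative D'' T) (at T within {0..<\<tau>1})"
    using dD dD' by (auto intro: has_field_derivative_at_within)
  moreover note contD'' bot
  ultimately show ?thesis
    by (intro exI[of _ D] exI[of _ D'] exI[of _ D''] conjI) blast+
qed

end
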